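(* Let $\mathcal{M}$ be a finite dimensional von Neumann algebra, $\mathcal{N}$ a von Neumann subalgebra of $\mathcal{M}$, and $\rho$ a faithful state on $\mathcal{M}$. Let $\mathcal{P}_\rho$ denote the orthogonal projection of $\mathcal{M}$ onto $\mathcal{N}$ in the GNS inner product induced by $\rho$. Then: (1) $\mathcal{P}_\rho$ is a conditional expectation if and only if $\mathcal{N}$ is invariant under $\Delta_\rho$. (2) $\mathcal{P}_\rho$ is a conditional expectation if and only if $\mathcal{P}_\rho$ is real.
   Context: $\mathcal{M}$ is regarded as a unital $*$-subalgebra of $M_n(\mathbb{C})$; $\mathrm{Tr}$ is the trace on $M_n(\mathbb{C})$, $\mathbf{1}$ the identity. A von Neumann subalgebra is a $*$-subalgebra containing $\mathbf{1}$. States on $\mathcal{M}$ are identified with density matrices $\rho\in\mathcal{M}$ ($\rho\ge0$, $\mathrm{Tr}[\rho]=1$) via $\rho(X)=\mathrm{Tr}[\rho X]$; faithful means $\rho$ invertible. The GNS inner product induced by $\rho$ is $\langle X,Y\rangle_{GNS,\rho}=\mathrm{Tr}[\rho X^*Y]$. The modular operator is $\Delta_\rho(X)=\rho X\rho^{-1}$ on $\mathcal{M}$; "$\mathcal{N}$ is invariant under $\Delta_\rho$" means $\Delta_\rho(A)\in\mathcal{N}$ for all $A\in\mathcal{N}$. A linear map on $\mathcal{M}$ is real if it maps self-adjoint elements to self-adjoint elements. A conditional expectation from $\mathcal{M}$ onto $\mathcal{N}$ (in the sense of Umegaki) is a unital, order preserving linear projection $\mathcal{E}$ of $\mathcal{M}$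 onto $\mathcal{N}$ such that $\mathcal{E}(AXB)=A\mathcal{E}(X)B$ for all $A,B\in\mathcal{N}$, $X\in\mathcal{M}$, and $\mathcal{E}(X)^*\mathcal{E}(X)\le\mathcal{E}(X^*X)$ for all $X\in\mathcal{M}$. *)

theory Defs
  imports "HOL-Analysis.Analysis"
begin

definition madj :: "complex^'n^'m \<Rightarrow> complex^'m^'n" where
  "madj A = map_matrix cnj (transpose A)"

definition mscale :: "complex \<Rightarrow> complex^'n^'m \<Rightarrow> complex^'n^'m" where
  "mscale c A = map_matrix ((*) c) A"

text \<open>The quadratic form below is required to be a nonnegative real number for every
  complex vector \<open>v\<close>; this includes self-adjointness of \<open>A\<close>.\<close>

definition positive_semidef :: "complex^'n^'n \<Rightarrow> bool" where
  "positive_semidef A \<longleftrightarrow> (\<forall>v. (\<Sum>i\<in>UNIV. cnj (v $ i) * (A *v v) $ i) \<in> \<real>\<^sub>\<ge>\<^sub>0)"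

definition loewner_le :: "complex^'n^'n \<Rightarrow> complex^'n^'n \<Rightarrow> bool" (infix \<open>\<preceq>\<close> 50) where
  "A \<preceq> B \<longleftrightarrow> positive_semidef (B - A)"

definition unital_star_subalgebra :: "(complex^'n^'n) set \<Rightarrow> bool" where
  "unital_star_subalgebra M \<longleftrightarrow>
     mat 1 \<in> M \<and>
     (\<forall>A\<in>M. \<forall>B\<in>M. A + B \<in> M) \<and>
     (\<forall>c. \<forall>A\<in>M. mscale c A \<in> M) \<and>
     (\<forall>A\<in>M. \<forall>B\<in>M. A ** B \<in> M) \<and>
     (\<forall>A\<in>M. madj A \<in> M)"

definition von_neumann_subalgebra :: "(complex^'n^'n) set \<Rightarrow> (complex^'n^'n) set \<Rightarrow> bool" where
  "von_neumann_subalgebra N M \<longleftrightarrow> unital_star_subalgebra N \<and> N \<subseteq> M"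

definition state_on :: "(complex^'n^'n) set \<Rightarrow> complex^'n^'n \<Rightarrow> bool" where
  "state_on M \<rho> \<longleftrightarrow> \<rho> \<in> M \<and> positive_semidef \<rho> \<and> trace \<rho> = 1"

definition faithful_state_on :: "(complex^'n^'n) set \<Rightarrow> complex^'n^'n \<Rightarrow> bool" where
  "faithful_state_on M \<rho> \<longleftrightarrow> state_on M \<rho> \<and> invertible \<rho>"

definition gns_inner :: "complex^'n^'n \<Rightarrow> complex^'n^'n \<Rightarrow> complex^'n^'n \<Rightarrow> complex" where
  "gns_inner \<rho> X Y = trace (\<rho> ** madj X ** Y)"

text \<open>The orthogonal projection onto \<open>N\<close> sends \<open>X\<close> to the point \<open>Y\<close> of \<open>N\<close> for which
  \<open>X - Y\<close> is orthogonal to \<open>N\<close>. For faithful \<open>\<rho>\<close> and a linear subspace \<open>N\<close> there is exactly one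
  such \<open>Y\<close>. The ambient algebra does not enter the formula: the projection of \<open>M\<close> onto \<open>N\<close> is
  the restriction of this map to \<open>M\<close>.\<close>

definition gns_proj :: "complex^'n^'n \<Rightarrow> (complex^'n^'n) set \<Rightarrow> complex^'n^'n \<Rightarrow> complex^'n^'n" where
  "gns_proj \<rho> N X = (THE Y. Y \<in> N \<and> (\<forall>A\<in>N. gns_inner \<rho> A (X - Y) = 0))"

definition modular_op :: "complex^'n^'n \<Rightarrow> complex^'n^'n \<Rightarrow> complex^'n^'n" where
  "modular_op \<rho> X = \<rho> ** X ** matrix_inv \<rho>"

definition invariant_under ::
    "(complex^'n^'n) set \<Rightarrow> (complex^'n^'n \<Rightarrow> complex^'n^'n) \<Rightarrow> bool" where
  "invariant_under N T \<longleftrightarrow> (\<forall>A\<in>N. T A \<in> N)"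

definition linear_map_on ::
    "(complex^'n^'n) set \<Rightarrow> (complex^'n^'n \<Rightarrow> complex^'n^'n) \<Rightarrow> bool" where
  "linear_map_on M T \<longleftrightarrow>
     (\<forall>X\<in>M. \<forall>Y\<in>M. T (X + Y) = T X + T Y) \<and> (\<forall>c. \<forall>X\<in>M. T (mscale c X) = mscale c (T X))"

definition real_map_on ::
    "(complex^'n^'n) set \<Rightarrow> (complex^'n^'n \<Rightarrow> complex^'n^'n) \<Rightarrow> bool" where
  "real_map_on M T \<longleftrightarrow> (\<forall>X\<in>M. madj X = X \<longrightarrow> madj (T X) = T X)"

definition conditional_expectation ::
    "(complex^'n^'n) set \<Rightarrow> (complex^'n^'n) set \<Rightarrow> (complex^'n^'n \<Rightarrow> complex^'n^'n) \<Rightarrow> bool" where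
  "conditional_expectation M N E \<longleftrightarrow>
     linear_map_on M E \<and>
     E ` M = N \<and> (\<forall>X\<in>M. E (E X) = E X) \<and>
     E (mat 1) = mat 1 \<and>
     (\<forall>X\<in>M. \<forall>Y\<in>M. X \<preceq> Y \<longrightarrow> E X \<preceq> E Y) \<and>
     (\<forall>A\<in>N. \<forall>B\<in>N. \<forall>X\<in>M. E (A ** X ** B) = A ** E X ** B) \<and>
     (\<forall>X\<in>M. madj (E X) ** E X \<preceq> E (madj X ** X))"

end

theory Submission
  imports Defs
begin

text \<open>Write \<open>P\<close> for the GNS projection, which is always \<open>N\<close>-linear from the left. It is \<open>N\<close>-linear
  from the right and commutes with the adjoint as soon as one can move elements of \<open>N\<close> across
  \<open>\<rho>\<close>, which is invariance under the modular operator. Then \<open>P\<close> is positive: for \<open>Z \<ge> 0\<close>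
  and \<open>A \<in> N\<close>, \<open>Tr[\<rho> A\<^sup>* P(Z) A] = Tr[\<rho> A\<^sup>* Z A] \<ge> 0\<close>, and for an element of \<open>N\<close> this forces
  positivity.
  Conversely, if \<open>P\<close> is real then its kernel \<open>K\<close> in \<open>M\<close> is closed under the adjoint. For
  \<open>A \<in> N\<close> and \<open>X \<in> K\<close> this gives \<open>\<langle>X, \<rho> A \<rho>\<^sup>-\<^sup>1\<rangle> = Tr[\<rho> A X\<^sup>*] = \<langle>A\<^sup>*, X\<^sup>*\<rangle> = 0\<close>, so
  \<open>\<rho> A \<rho>\<^sup>-\<^sup>1\<close> is an element of \<open>M\<close> orthogonal to \<open>K\<close>, that is, an element of \<open>N\<close>.\<close>

section \<open>Positive semidefinite matrices\<close>

lemma madj_nth: "madj A $ i $ j = cnj (A $ j $ i)"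
  by (simp add: madj_def transpose_def)

lemma mscale_nth: "mscale c A $ i $ j = c * A $ i $ j"
  by (simp add: mscale_def)

lemma madj_madj [simp]: "madj (madj A) = A"
  by (simp add: vec_eq_iff madj_nth)

lemma madj_mult: "madj (A ** B) = madj B ** madj A"
  by (simp add: vec_eq_iff madj_nth matrix_matrix_mult_def mult.commute)

lemma madj_add: "madj (A + B) = madj A + madj B"
  by (simp add: vec_eq_iff madj_nth)

lemma madj_diff: "madj (A - B) = madj A - madj B"
  by (simp add: vec_eq_iff madj_nth)

lemma madj_mscale: "madj (mscale c A) = mscale (cnj c) (madj A)"
  by (simp add: vec_eq_iff madj_nth mscale_nth)

lemma madj_mat_1 [simp]: "madj (mat 1) = mat 1"
  by (simp add: vec_eq_iff madj_nth mat_def)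

lemma mscale_mult_left: "mscale c A ** B = mscale c (A ** B)"
  by (simp add: vec_eq_iff mscale_nth matrix_matrix_mult_def sum_distrib_left mult.assoc)

lemma mscale_mult_right: "A ** mscale c B = mscale c (A ** B)"
  by (simp add: vec_eq_iff mscale_nth matrix_matrix_mult_def sum_distrib_left mult.left_commute)

lemma mscale_mult_vec: "mscale c A *v v = c *s (A *v v)"
  by (simp add: vec_eq_iff mscale_nth matrix_vector_mult_def sum_distrib_left mult.assoc)

lemma mscale_of_real: "mscale (of_real r) A = r *\<^sub>R A"
  by (simp add: vec_eq_iff mscale_nth scaleR_conv_of_real[where 'a=complex])

lemma mscale_uminus_1: "mscale (-1) A = - A"
  by (simp add: vec_eq_iff mscale_nth)

lemma matrix_diff_ldistrib: "(A :: complex^'m^'n) ** (B - C) = A ** B - A ** C"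
  by (simp add: vec_eq_iff matrix_matrix_mult_def algebra_simps sum_subtractf)

lemma matrix_diff_rdistrib: "((A :: complex^'m^'n) - B) ** C = A ** C - B ** C"
  by (simp add: vec_eq_iff matrix_matrix_mult_def algebra_simps sum_subtractf)

lemma matrix_add_rdistrib: "((A :: complex^'m^'n) + B) ** C = A ** C + B ** C"
  by (simp add: vec_eq_iff matrix_matrix_mult_def algebra_simps sum.distrib)

lemma trace_madj: "trace (madj A) = cnj (trace A)"
  by (simp add: trace_def madj_nth)

lemma trace_mscale: "trace (mscale c A) = c * trace A"
  by (simp add: trace_def mscale_nth sum_distrib_left)

text \<open>The Euclidean inner product on matrices is the real part of the Hilbert-Schmidt form, so
  facts about dimensions of orthogonal complements become applicable.\<close>

lemma inner_complex_matrix: "X \<bullet> Y = Re (trace (madj X ** Y))" for X Y :: "complex^'n^'m"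
proof -
  have "X \<bullet> Y = (\<Sum>i\<in>UNIV. \<Sum>j\<in>UNIV. X $ i $ j \<bullet> Y $ i $ j)"
    by (simp add: inner_vec_def)
  also have "\<dots> = (\<Sum>j\<in>UNIV. \<Sum>i\<in>UNIV. X $ i $ j \<bullet> Y $ i $ j)"
    by (rule sum.swap)
  finally show ?thesis
    by (simp add: trace_def matrix_matrix_mult_def madj_nth inner_complex_def)
qed

section \<open>The sesquilinear form of a matrix\<close>

definition hform :: "complex^'n^'m \<Rightarrow> complex^'m \<Rightarrow> complex^'n \<Rightarrow> complex" where
  "hform A v w = (\<Sum>i\<in>UNIV. cnj (v $ i) * (A *v w) $ i)"

lemma hform_add_left: "hform A (u + v) w = hform A u w + hform A v w"
  by (simp add: hform_def algebra_simps sum.distrib)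

lemma hform_add_right: "hform A u (v + w) = hform A u v + hform A u w"
  by (simp add: hform_def algebra_simps sum.distrib)

lemma hform_smult_left: "hform A (c *s v) w = cnj c * hform A v w"
  by (simp add: hform_def sum_distrib_left mult.assoc)

lemma hform_smult_right: "hform A v (c *s w) = c * hform A v w"
  by (simp add: hform_def vector_scalar_commute sum_distrib_left mult.left_commute)

lemma hform_diff_left: "hform A (u - v) w = hform A u w - hform A v w"
  by (simp add: hform_def algebra_simps sum_subtractf)

lemma hform_diff_right: "hform A u (v - w) = hform A u v - hform A u w"
  by (simp add: hform_def algebra_simps sum_subtractf)

lemmas hform_linear = hform_add_left hform_add_right hform_diff_left hform_diff_right
  hform_smult_left hform_smult_right

lemma hform_diff_matrix: "hform (A - B) v w = hform A v w - hform B v w"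
  by (simp add: hform_def matrix_vector_mult_diff_rdistrib algebra_simps sum_subtractf)

lemma hform_mscale: "hform (mscale c A) v w = c * hform A v w"
  by (simp add: hform_def mscale_mult_vec sum_distrib_left mult.left_commute)

lemma hform_expand: "hform A v w = (\<Sum>i\<in>UNIV. \<Sum>j\<in>UNIV. cnj (v $ i) * A $ i $ j * w $ j)"
  by (simp add: hform_def matrix_vector_mult_def sum_distrib_left mult.assoc)

lemma matrix_vector_axis: "(A *v axis j 1) $ i = A $ i $ j" for A :: "complex^'n^'m"
  by (simp add: matrix_vector_mult_def axis_def if_distrib[of "\<lambda>x. _ * x"] cong: if_cong)

text \<open>Entries are values of the form, so a matrix is determined by its form.\<close>

lemma hform_axis: "hform A (axis i 1) (axis j 1) = A $ i $ j"
  by (simp add: hform_def matrix_vector_axis)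
     (simp add: axis_def if_distrib[of cnj] if_distrib[of "\<lambda>x. x * _"] cong: if_cong)

lemma hform_madj: "hform (madj A) v w = cnj (hform A w v)"
  unfolding hform_expand by (subst sum.swap) (simp add: madj_nth ac_simps)

lemma hform_mult_right: "hform (A ** B) v w = hform A v (B *v w)"
  by (simp add: hform_def matrix_vector_mul_assoc)

lemma hform_mult_madj_left: "hform (madj B ** A) v w = hform A (B *v v) w"
  using hform_madj[of "madj A ** B" v w]
  by (simp add: madj_mult hform_mult_right hform_madj)

lemma hform_mat_1_self: "hform (mat 1) v v = of_real ((norm v)\<^sup>2)"
proof -
  have "(norm v)\<^sup>2 = (\<Sum>i\<in>UNIV. (norm (v $ i))\<^sup>2)"
    by (simp add: norm_vec_def L2_set_def sum_nonneg)
  thus ?thesis by (simp add: hform_def complex_norm_square mult.commute del: of_real_power)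
qed

section \<open>Positivity, trace and the least eigenvalue\<close>

lemma positive_semidef_iff_hform:
  "positive_semidef A \<longleftrightarrow> (\<forall>v. 0 \<le> Re (hform A v v) \<and> Im (hform A v v) = 0)"
  by (simp add: positive_semidef_def hform_def complex_nonneg_Reals_iff)

lemma positive_semidef_madj:
  assumes "positive_semidef A"
  shows "madj A = A"
proof -
  have im: "Im (hform A v v) = 0" for v
    using assms by (simp add: positive_semidef_iff_hform)
  \<comment> \<open>Polarization: the value at \<open>v + w\<close> compares the imaginary parts,
    the value at \<open>v + \<i> *s w\<close> the real parts.\<close>
  have "hform A v w = cnj (hform A w v)" for v w
    using im[of v] im[of w] im[of "v + w"] im[of "v + \<i> *s w"]
    by (simp add: hform_linear complex_eq_iff)
  hence "hform (madj A) v w = hform A v w" for v w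
    by (metis hform_madj)
  thus ?thesis by (metis vec_eq_iff hform_axis)
qed

lemma hform_sym:
  assumes "madj A = A"
  shows "hform A v w = cnj (hform A w v)"
  using hform_madj[of A v w] assms by simp

lemma hform_sym_self:
  assumes "madj A = A"
  shows "Im (hform A v v) = 0"
  using hform_sym[OF assms, of v v] by (simp add: complex_eq_iff)

lemma hform_conjugate: "hform (madj B ** A ** B) v w = hform A (B *v v) (B *v w)"
  by (metis hform_mult_right hform_mult_madj_left)

lemma positive_semidef_conjugate:
  assumes "positive_semidef A"
  shows "positive_semidef (madj B ** A ** B)"
  using assms by (simp add: positive_semidef_iff_hform hform_conjugate)

lemma positive_semidef_mat_1: "positive_semidef (mat 1)"
  by (simp add: positive_semidef_iff_hform hform_mat_1_self)

lemma positive_semidef_square: "positive_semidef (madj B ** B)"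
  using positive_semidef_conjugate[OF positive_semidef_mat_1, of B] by simp

text \<open>Moving from \<open>v\<close> by \<open>- s\<close> times \<open>A *v v\<close> changes
  the form by a linear term proportional to the squared norm of \<open>A *v v\<close> and a
  quadratic term. Nonnegativity for small \<open>s > 0\<close> forces that norm to vanish.\<close>

lemma positive_semidef_null:
  assumes A: "positive_semidef A" and v: "hform A v v = 0"
  shows "A *v v = 0"
proof -
  define w where "w = A *v v"
  define b where "b = (norm w)\<^sup>2"
  define q where "q = Re (hform A w w)"
  have wv: "hform A w v = of_real b"
    unfolding b_def w_def by (metis hform_mult_right matrix_mul_lid hform_mat_1_self)
  hence vw: "hform A v w = of_real b"
    using hform_sym[OF positive_semidef_madj[OF A], of v w] by simp
  have key: "2 * s * b \<le> s\<^sup>2 * q" for s :: real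
  proof -
    have "0 \<le> Re (hform A (v + of_real (- s) *s w) (v + of_real (- s) *s w))"
      using A by (simp add: positive_semidef_iff_hform)
    also have "\<dots> = - 2 * s * b + s\<^sup>2 * q"
      by (simp add: hform_linear v wv vw q_def power2_eq_square algebra_simps)
    finally show ?thesis by simp
  qed
  have "0 \<le> q" using A by (simp add: positive_semidef_iff_hform q_def)
  have b: "0 \<le> b" by (simp add: b_def)
  have "b \<le> 0"
  proof (cases "q = 0")
    case True
    thus ?thesis using key[of 1] by simp
  next
    case False
    with \<open>0 \<le> q\<close> have "0 < q" by simp
    \<comment> \<open>This \<open>s\<close> minimizes the quadratic and turns \<open>key\<close>
      into \<open>2 * b\<^sup>2 / q \<le> b\<^sup>2 / q\<close>.\<close>
    thus ?thesis using key[of "b / q"] b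
      by (simp add: power2_eq_square field_simps mult_le_0_iff)
  qed
  thus ?thesis using b by (simp add: b_def w_def)
qed

text \<open>One step of the Cholesky decomposition removes a nonzero diagonal entry from the first
  factor and splits off a rank one positive matrix.\<close>

lemma trace_mult_positive_semidef:
  fixes A B :: "complex^'n^'n"
  assumes "positive_semidef A" "positive_semidef B"
  shows "trace (A ** B) \<in> \<real>\<^sub>\<ge>\<^sub>0"
  using assms(1)
proof (induction "card {i. A $ i $ i \<noteq> 0}" arbitrary: A rule: less_induct)
  case less
  note A = \<open>positive_semidef A\<close>
  have diag: "0 \<le> Re (A $ i $ i)" "Im (A $ i $ i) = 0" if "positive_semidef A" for A i
    using that by (auto simp: positive_semidef_iff_hform simp flip: hform_axis)
  show ?case
  proof (cases "\<forall>i. A $ i $ i = 0")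
    case True
    hence "A *v axis i 1 = 0" for i
      by (intro positive_semidef_null[OF A]) (simp add: hform_axis)
    hence "A = 0"
      by (simp add: vec_eq_iff flip: hform_axis) (simp add: hform_def)
    thus ?thesis by (simp add: trace_def matrix_matrix_mult_def)
  next
    case False
    then obtain i where i: "A $ i $ i \<noteq> 0" by blast
    define e where "e = (axis i 1 :: complex^'n)"
    define a where "a = Re (A $ i $ i)"
    have Aii: "A $ i $ i = of_real a"
      using diag[OF A] by (simp add: a_def complex_eq_iff)
    have a: "0 < a" using diag(1)[OF A, of i] i unfolding Aii by simp
    define x where "x = A *v e"
    \<comment> \<open>The rank one matrix built from column \<open>i\<close> of \<open>A\<close>;
      subtracting it clears row and column \<open>i\<close>, leaving the Schur complement.\<close>
    define C where "C = (\<chi> j k. x $ j * cnj (x $ k) / a)"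
    have x: "(\<Sum>j\<in>UNIV. cnj (w $ j) * x $ j) = hform A w e" for w
      by (simp add: hform_def x_def)
    have symm: "hform A w e = cnj (hform A e w)" for w
      by (rule hform_sym[OF positive_semidef_madj[OF A]])
    have C: "hform C w w = of_real ((norm (hform A e w))\<^sup>2 / a)" for w
    proof -
      have "hform C w w
          = (\<Sum>j\<in>UNIV. cnj (w $ j) * x $ j) * cnj (\<Sum>j\<in>UNIV. cnj (w $ j) * x $ j) / a"
        by (simp add: hform_expand C_def sum_product sum_divide_distrib ac_simps) (rule sum.swap)
      thus ?thesis
        unfolding x by (simp add: symm[of w] complex_norm_square mult.commute del: of_real_power)
    qed
    have AC: "positive_semidef (A - C)"
      unfolding positive_semidef_iff_hform
    proof
      fix w
      define b where "b = hform A e w"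
      \<comment> \<open>Completing the square: this shift along \<open>e\<close> lowers the form of
        \<open>A\<close> at \<open>w\<close> by exactly the form of \<open>C\<close> at
        \<open>w\<close>.\<close>
      define u where "u = w + (- (b / a)) *s e"
      have "hform A u u = hform (A - C) w w"
        using a symm[of w]
        by (simp add: u_def hform_linear hform_diff_matrix C hform_axis Aii e_def
            b_def[unfolded e_def, symmetric] complex_norm_square del: of_real_power)
      thus "0 \<le> Re (hform (A - C) w w) \<and> Im (hform (A - C) w w) = 0"
        using A by (metis positive_semidef_iff_hform)
    qed
    have "C $ j $ j = of_real ((norm (hform A e (axis j 1)))\<^sup>2 / a)" for j
      using C[of "axis j 1"] by (simp add: hform_axis)
    hence Cj: "0 \<le> Re (C $ j $ j)" for j
      using a by simp
    have "x $ i = a"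
      by (simp add: x_def e_def matrix_vector_axis Aii)
    hence "(A - C) $ i $ i = 0"
      using a by (simp add: C_def Aii)
    \<comment> \<open>No new nonzero diagonal entry appears: such an entry equals minus that of
      \<open>C\<close>, so it is both nonnegative and nonpositive.\<close>
    moreover have "(A - C) $ j $ j = 0" if "A $ j $ j = 0" for j
      using diag[OF AC, of j] Cj[of j] that by (auto simp: complex_eq_iff)
    ultimately have "{j. (A - C) $ j $ j \<noteq> 0} \<subset> {j. A $ j $ j \<noteq> 0}"
      using i by blast
    hence "card {j. (A - C) $ j $ j \<noteq> 0} < card {j. A $ j $ j \<noteq> 0}"
      by (intro psubset_card_mono) auto
    hence "trace ((A - C) ** B) \<in> \<real>\<^sub>\<ge>\<^sub>0"
      using less.hyps AC by blast
    moreover have "trace (C ** B) = hform B x x / a"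
      unfolding hform_expand trace_def matrix_matrix_mult_def C_def
      by (subst sum.swap) (simp add: sum_divide_distrib ac_simps)
    hence "trace (C ** B) \<in> \<real>\<^sub>\<ge>\<^sub>0"
      using assms(2) a by (simp add: positive_semidef_iff_hform complex_nonneg_Reals_iff)
    moreover have "trace (A ** B) = trace ((A - C) ** B) + trace (C ** B)"
      by (simp add: matrix_diff_rdistrib trace_sub)
    ultimately show ?thesis by (simp add: nonneg_Reals_add_I)
  qed
qed

text \<open>The diagonal entries of \<open>B ** A ** madj B\<close> are nonnegative with sum zero,
  so \<open>A\<close> annihilates every column of \<open>madj B\<close>. This yields definiteness of
  the GNS inner product.\<close>

lemma positive_semidef_trace_conjugate_eq_0:
  assumes A: "positive_semidef A" "invertible A" and tr: "trace (B ** A ** madj B) = 0"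
  shows "B = 0"
proof -
  have psd: "positive_semidef (B ** A ** madj B)"
    using positive_semidef_conjugate[OF A(1), of "madj B"] by simp
  have nonneg: "0 \<le> Re ((B ** A ** madj B) $ i $ i)" "Im ((B ** A ** madj B) $ i $ i) = 0" for i
    using psd by (auto simp: positive_semidef_iff_hform simp flip: hform_axis)
  have "(\<Sum>i\<in>UNIV. Re ((B ** A ** madj B) $ i $ i)) = 0"
    using arg_cong[OF tr, of Re] by (simp add: trace_def)
  hence "Re ((B ** A ** madj B) $ i $ i) = 0" for i
    using nonneg(1) by (simp add: sum_nonneg_eq_0_iff)
  hence "(B ** A ** madj B) $ i $ i = 0" for i
    using nonneg(2) by (simp add: complex_eq_iff)
  hence "hform A (madj B *v axis i 1) (madj B *v axis i 1) = 0" for i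
    using hform_conjugate[of "madj B" A] by (simp flip: hform_axis)
  hence "A *v (madj B *v axis i 1) = 0" for i
    by (rule positive_semidef_null[OF A(1)])
  moreover obtain A' where "A' ** A = mat 1"
    using A(2) by (auto simp: invertible_def)
  ultimately have "madj B *v axis i 1 = 0" for i
    by (metis matrix_vector_mul_assoc matrix_vector_mul_lid matrix_vector_mult_0_right)
  hence "madj B $ i $ j = 0" for i j
    by (simp flip: hform_axis) (simp add: hform_def)
  thus ?thesis by (simp add: vec_eq_iff madj_nth)
qed

text \<open>The form attains its minimum \<open>l\<close> on the compact unit sphere. By
  homogeneity, \<open>A\<close> minus \<open>l\<close> is positive semidefinite; its form vanishes
  at the minimizer, which is therefore a null vector.\<close>

lemma exists_least_eigenvalue:
  fixes A :: "complex^'n^'n"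
  assumes A: "madj A = A"
  obtains l :: real and v where "v \<noteq> 0" "positive_semidef (A - mscale l (mat 1))"
    "(A - mscale l (mat 1)) *v v = 0"
proof -
  have "continuous_on (sphere 0 1) (\<lambda>v. Re (hform A v v))"
    unfolding hform_expand by (intro continuous_intros)
  moreover have "compact (sphere (0 :: complex^'n) 1)" by simp
  moreover have "sphere (0 :: complex^'n) 1 \<noteq> {}"
    by simp
  ultimately obtain v where v: "norm v = 1"
    and min: "\<And>w. norm w = 1 \<Longrightarrow> Re (hform A v v) \<le> Re (hform A w w)"
    using continuous_attains_inf[of "sphere 0 1" "\<lambda>v. Re (hform A v v)"] by auto
  define l where "l = Re (hform A v v)"
  define B where "B = A - mscale l (mat 1)"
  have B: "hform B w w = of_real (Re (hform A w w) - l * (norm w)\<^sup>2)" for w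
    using hform_sym_self[OF A, of w]
    by (simp add: B_def hform_diff_matrix hform_mscale hform_mat_1_self complex_eq_iff
        del: of_real_power)
  have "0 \<le> Re (hform A w w) - l * (norm w)\<^sup>2" for w
  proof (cases "w = 0")
    case True
    thus ?thesis by (simp add: hform_def)
  next
    case False
    define u where "u = complex_of_real (1 / norm w) *s w"
    have u: "u = (1 / norm w) *\<^sub>R w"
      by (simp add: u_def vec_eq_iff scaleR_conv_of_real[where 'a=complex])
    hence "norm u = 1" using False by simp
    from min[OF this] have "l \<le> Re (hform A u u)" by (simp add: l_def)
    also have "\<dots> = Re (hform A w w) / (norm w)\<^sup>2"
      by (simp add: u_def hform_linear power2_eq_square)
    finally show ?thesis using False by (simp add: field_simps)
  qed
  hence psd: "positive_semidef B"
    by (simp add: positive_semidef_iff_hform B del: of_real_diff of_real_mult of_real_power)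
  have "hform B v v = 0" by (simp add: B v l_def)
  hence "B *v v = 0" by (rule positive_semidef_null[OF psd])
  moreover have "v \<noteq> 0" using v by auto
  ultimately show ?thesis using that psd by (simp add: B_def)
qed

section \<open>The GNS projection\<close>

lemma invertible_matrix_inv:
  assumes "invertible A"
  shows "A ** matrix_inv A = mat 1" "matrix_inv A ** A = mat 1"
  using someI_ex[OF assms[unfolded invertible_def]] by (simp_all add: matrix_inv_def)

locale star_subalgebra =
  fixes N :: "(complex^'n^'n) set"
  assumes N: "unital_star_subalgebra N"
begin

lemma one_mem: "mat 1 \<in> N"
  and add_mem: "A \<in> N \<Longrightarrow> B \<in> N \<Longrightarrow> A + B \<in> N"
  and mscale_mem: "A \<in> N \<Longrightarrow> mscale c A \<in> N"
  and mult_mem: "A \<in> N \<Longrightarrow> B \<in> N \<Longrightarrow> A ** B \<in> N"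
  and madj_mem: "A \<in> N \<Longrightarrow> madj A \<in> N"
  using N by (auto simp: unital_star_subalgebra_def)

lemma diff_mem: "A \<in> N \<Longrightarrow> B \<in> N \<Longrightarrow> A - B \<in> N"
  using add_mem[of A "mscale (-1) B"] mscale_mem[of B "-1"] by (simp add: mscale_uminus_1)

lemma subspace: "subspace N"
  unfolding subspace_def
  using diff_mem[OF one_mem one_mem] add_mem mscale_mem by (auto simp flip: mscale_of_real)

text \<open>Left multiplication by \<open>Z\<close> is an injective linear map of the finite
  dimensional space \<open>N\<close> into itself, hence onto, and so reaches the identity.\<close>

lemma right_inverse_mem:
  assumes Z: "Z \<in> N" and inj: "\<And>A. A \<in> N \<Longrightarrow> Z ** A = 0 \<Longrightarrow> A = 0"
  obtains B where "B \<in> N" "Z ** B = mat 1"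
proof -
  have lin: "linear (\<lambda>A. Z ** A)"
    by (rule linearI) (simp_all add: matrix_add_ldistrib mscale_mult_right flip: mscale_of_real)
  have "inj_on (\<lambda>A. Z ** A) N"
  proof (rule inj_onI)
    fix A B assume "A \<in> N" "B \<in> N" "Z ** A = Z ** B"
    thus "A = B" using inj[OF diff_mem[of A B]] by (simp add: matrix_diff_ldistrib)
  qed
  hence "dim ((\<lambda>A. Z ** A) ` N) = dim N"
    using subspace by (intro dim_image_eq[OF lin]) (simp add: span_eq_iff[THEN iffD2])
  hence "(\<lambda>A. Z ** A) ` N = N"
    using Z mult_mem by (intro subspace_dim_equal linear_subspace_image[OF lin] subspace) auto
  thus ?thesis using one_mem that by (metis imageE)
qed

lemma matrix_inv_mem:
  assumes Z: "Z \<in> N" "invertible Z"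
  shows "matrix_inv Z \<in> N"
proof -
  note inv = invertible_matrix_inv[OF Z(2)]
  obtain B where B: "B \<in> N" "Z ** B = mat 1"
  proof (rule right_inverse_mem[OF Z(1)])
    show "A = 0" if "Z ** A = 0" for A
      using arg_cong[OF that, of "\<lambda>X. matrix_inv Z ** X"] inv(2)
      by (simp add: matrix_mul_assoc)
  qed
  have "B = matrix_inv Z ** (Z ** B)" by (simp add: matrix_mul_assoc inv)
  with B show ?thesis by simp
qed

end

text \<open>The Schwarz inequality makes \<open>E (madj X ** X)\<close> self-adjoint, as the sum of
  a positive matrix and a square. Every self-adjoint element is a real combination of such
  squares.\<close>

lemma conditional_expectation_imp_real:
  assumes M: "unital_star_subalgebra M" and E: "conditional_expectation M N E"
  shows "real_map_on M E"
  unfolding real_map_on_def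
proof (intro ballI impI)
  interpret M: star_subalgebra M by unfold_locales (rule M)
  have E_add: "Y \<in> M \<Longrightarrow> E (X + Y) = E X + E Y"
    and E_mscale: "E (mscale c X) = mscale c (E X)"
    and schwarz: "madj (E X) ** E X \<preceq> E (madj X ** X)"
    if "X \<in> M" for X Y c
    using E that by (auto simp: conditional_expectation_def linear_map_on_def)
  have sq: "madj (E (madj X ** X)) = E (madj X ** X)" if "X \<in> M" for X
    using positive_semidef_madj[OF schwarz[OF that, unfolded loewner_le_def]]
    by (simp add: madj_diff madj_mult)
  fix X assume X: "X \<in> M" "madj X = X"
  \<comment> \<open>For self-adjoint \<open>X\<close>: twice \<open>X\<close> is the square of
    \<open>X + 1\<close> minus the squares of \<open>X\<close> and \<open>1\<close>.\<close>
  have "mscale 2 X = madj (X + mat 1) ** (X + mat 1)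
      + mscale (-1) (madj X ** X + madj (mat 1) ** mat 1)"
    by (simp add: X madj_add matrix_add_ldistrib matrix_add_rdistrib mscale_uminus_1)
       (simp add: vec_eq_iff mscale_nth)
  moreover note XM = M.add_mem[OF X(1) M.one_mem]
  ultimately have "E (mscale 2 X) = E (madj (X + mat 1) ** (X + mat 1))
     + mscale (-1) (E (madj X ** X) + E (madj (mat 1) ** mat 1))"
    by (simp only: E_add E_mscale M.mult_mem M.madj_mem M.add_mem M.mscale_mem X(1) M.one_mem XM)
  hence "madj (mscale 2 (E X)) = mscale 2 (E X)"
    using sq[OF XM] sq[OF X(1)] sq[OF M.one_mem]
    by (simp only: E_mscale[OF X(1)] madj_add madj_mscale) simp
  thus "madj (E X) = E X"
    by (simp add: madj_mscale vec_eq_iff mscale_nth)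
qed

section \<open>The GNS inner product and existence of the projection\<close>

lemma gns_inner_add_right: "gns_inner \<rho> A (X + Y) = gns_inner \<rho> A X + gns_inner \<rho> A Y"
  by (simp add: gns_inner_def matrix_add_ldistrib trace_add)

lemma gns_inner_diff_right: "gns_inner \<rho> A (X - Y) = gns_inner \<rho> A X - gns_inner \<rho> A Y"
  by (simp add: gns_inner_def matrix_diff_ldistrib trace_sub)

lemma gns_inner_zero_right: "gns_inner \<rho> A 0 = 0"
  using gns_inner_diff_right[of \<rho> A 0 0] by simp

lemma gns_inner_mscale_right: "gns_inner \<rho> A (mscale c X) = c * gns_inner \<rho> A X"
  by (simp add: gns_inner_def mscale_mult_right trace_mscale)

lemma gns_inner_mscale_left: "gns_inner \<rho> (mscale c A) X = cnj c * gns_inner \<rho> A X"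
  by (simp add: gns_inner_def madj_mscale mscale_mult_left mscale_mult_right trace_mscale)

lemma gns_inner_mult_left: "gns_inner \<rho> C (A ** X) = gns_inner \<rho> (madj A ** C) X"
  by (simp add: gns_inner_def madj_mult matrix_mul_assoc)

text \<open>By cyclicity of the trace, a right factor \<open>B\<close> can be moved to the other
  argument once it has been carried across \<open>\<rho>\<close>; this is where the modular operator
  enters.\<close>

lemma gns_inner_mult_right:
  assumes "\<rho> ** D = B ** \<rho>"
  shows "gns_inner \<rho> C (X ** B) = gns_inner \<rho> (C ** madj D) X"
proof -
  have "gns_inner \<rho> C (X ** B) = trace (B ** (\<rho> ** madj C ** X))"
    by (subst trace_mul_sym) (simp add: gns_inner_def matrix_mul_assoc)
  also have "\<dots> = trace (\<rho> ** D ** madj C ** X)"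
    by (simp add: assms matrix_mul_assoc)
  finally show ?thesis by (simp add: gns_inner_def madj_mult matrix_mul_assoc)
qed

locale gns_subalgebra = star_subalgebra N for N :: "(complex^'n^'n) set" +
  fixes \<rho> :: "complex^'n^'n"
  assumes rho_psd: "positive_semidef \<rho>" and rho_inv: "invertible \<rho>"
begin

abbreviation "P \<equiv> gns_proj \<rho> N"

lemma madj_rho: "madj \<rho> = \<rho>"
  by (rule positive_semidef_madj[OF rho_psd])

lemma gns_inner_cnj: "cnj (gns_inner \<rho> X Y) = gns_inner \<rho> Y X"
proof -
  have "cnj (gns_inner \<rho> X Y) = trace (madj Y ** X ** \<rho>)"
    by (simp add: gns_inner_def madj_mult madj_rho matrix_mul_assoc flip: trace_madj)
  also have "\<dots> = trace (\<rho> ** (madj Y ** X))" by (rule trace_mul_sym)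
  finally show ?thesis by (simp add: gns_inner_def matrix_mul_assoc)
qed

lemma gns_inner_madj_right:
  assumes "\<rho> ** D = C ** \<rho>"
  shows "gns_inner \<rho> C (madj X) = cnj (gns_inner \<rho> (madj D) X)"
proof -
  have "gns_inner \<rho> C (madj X) = cnj (trace (X ** (C ** \<rho>)))"
    by (simp add: gns_inner_def madj_mult madj_rho matrix_mul_assoc flip: trace_madj)
  also have "\<dots> = cnj (trace (\<rho> ** D ** X))"
    by (subst trace_mul_sym) (simp add: assms)
  finally show ?thesis by (simp add: gns_inner_def)
qed

lemma gns_inner_positive_semidef:
  assumes "positive_semidef Z"
  shows "gns_inner \<rho> A (Z ** A) \<in> \<real>\<^sub>\<ge>\<^sub>0"
  using trace_mult_positive_semidef[OF rho_psd positive_semidef_conjugate[OF assms, of A]]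
  by (simp add: gns_inner_def matrix_mul_assoc)

lemma gns_inner_self: "0 \<le> Re (gns_inner \<rho> X X)" "Im (gns_inner \<rho> X X) = 0"
  using gns_inner_positive_semidef[OF positive_semidef_mat_1, of X]
  by (simp_all add: complex_nonneg_Reals_iff)

lemma gns_inner_self_eq_0:
  assumes "gns_inner \<rho> X X = 0"
  shows "X = 0"
proof (rule positive_semidef_trace_conjugate_eq_0[OF rho_psd rho_inv])
  have "trace (X ** (\<rho> ** madj X)) = 0"
    using assms by (subst trace_mul_sym) (simp add: gns_inner_def)
  thus "trace (X ** \<rho> ** madj X) = 0" by (simp add: matrix_mul_assoc)
qed

text \<open>The real orthogonal complement of \<open>N\<close> for \<open>Re (gns_inner \<rho>)\<close> is the Hilbert-Schmidt
  complement multiplied by the inverse of \<open>\<rho>\<close>, hence has the complementary dimension.\<close>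

lemma gns_decomposition:
  obtains Y where "Y \<in> N" "\<And>A. A \<in> N \<Longrightarrow> gns_inner \<rho> A (X - Y) = 0"
proof -
  define W where "W = {Z. \<forall>A\<in>N. orthogonal A Z}"
  define f :: "complex^'n^'n \<Rightarrow> complex^'n^'n" where "f = (\<lambda>Z. Z ** matrix_inv \<rho>)"
  have lin: "linear f"
    unfolding f_def
    by (rule linearI) (simp_all add: matrix_add_rdistrib mscale_mult_left flip: mscale_of_real)
  have inv: "f Z ** \<rho> = Z" for Z
    by (simp add: f_def invertible_matrix_inv[OF rho_inv] flip: matrix_mul_assoc)
  have "inj f" by (metis injI inv)
  have W: "subspace W"
    by (auto simp: W_def subspace_def orthogonal_clauses)
  have fW: "Re (gns_inner \<rho> A Z) = 0" if "Z \<in> f ` W" "A \<in> N" for A Z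
  proof -
    have "0 = A \<bullet> (Z ** \<rho>)" using that by (auto simp: inv W_def orthogonal_def)
    also have "\<dots> = Re (trace (madj A ** Z ** \<rho>))"
      by (simp add: inner_complex_matrix matrix_mul_assoc)
    also have "\<dots> = Re (gns_inner \<rho> A Z)"
      by (subst trace_mul_sym) (simp add: gns_inner_def matrix_mul_assoc)
    finally show ?thesis by simp
  qed
  \<comment> \<open>Definiteness makes the two subspaces independent, so their dimensions add up to
    that of the whole space.\<close>
  have "f ` W \<inter> N \<subseteq> {0}"
  proof
    fix Z assume "Z \<in> f ` W \<inter> N"
    hence "gns_inner \<rho> Z Z = 0"
      using fW gns_inner_self by (auto simp: complex_eq_iff)
    thus "Z \<in> {0}" using gns_inner_self_eq_0 by blast
  qed
  hence "dim (f ` W \<inter> N) = 0" by (simp add: dim_eq_0)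
  moreover have "dim (f ` W) = dim W"
    using \<open>inj f\<close> by (intro dim_image_eq[OF lin]) (auto intro: inj_on_subset)
  moreover have "dim W + dim N = DIM(complex^'n^'n)"
    using dim_subspace_orthogonal_to_vectors[OF subspace subspace_UNIV] by (simp add: W_def)
  ultimately have "dim {x + y | x y. x \<in> f ` W \<and> y \<in> N} = DIM(complex^'n^'n)"
    using dim_sums_Int[OF linear_subspace_image[OF lin W] subspace] by linarith
  hence "span {x + y | x y. x \<in> f ` W \<and> y \<in> N} = UNIV" by (rule dim_eq_full[THEN iffD1])
  moreover have "subspace {x + y | x y. x \<in> f ` W \<and> y \<in> N}"
    by (rule subspace_sums[OF linear_subspace_image[OF lin W] subspace])
  ultimately have "{x + y | x y. x \<in> f ` W \<and> y \<in> N} = UNIV"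
    by (simp only: span_eq_iff[symmetric])
  then obtain Z Y where Z: "Z \<in> f ` W" and Y: "Y \<in> N" and X: "X = Z + Y" by blast
  \<comment> \<open>Real orthogonality to both \<open>A\<close> and \<open>\<i>\<close> times
    \<open>A\<close> gives complex orthogonality.\<close>
  have "gns_inner \<rho> A (X - Y) = 0" if A: "A \<in> N" for A
    using fW[OF Z A] fW[OF Z mscale_mem[OF A, of \<i>]]
    by (simp add: X complex_eq_iff gns_inner_mscale_left)
  thus ?thesis using that Y by blast
qed

text \<open>Two candidates differ by an element of \<open>N\<close> orthogonal to itself. The
  algebraic properties of \<open>P\<close> below come from this characterization.\<close>

lemma proj_eqI:
  assumes "Y \<in> N" "\<And>A. A \<in> N \<Longrightarrow> gns_inner \<rho> A (X - Y) = 0"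
  shows "P X = Y"
  unfolding gns_proj_def
proof (rule the_equality)
  fix Y' assume Y': "Y' \<in> N \<and> (\<forall>A\<in>N. gns_inner \<rho> A (X - Y') = 0)"
  have "gns_inner \<rho> (Y' - Y) (X - Y) - gns_inner \<rho> (Y' - Y) (X - Y') = 0"
    using Y' assms diff_mem by simp
  hence "gns_inner \<rho> (Y' - Y) (Y' - Y) = 0"
    by (simp flip: gns_inner_diff_right)
  thus "Y' = Y" using gns_inner_self_eq_0 by fastforce
qed (use assms in blast)

lemma proj_mem: "P X \<in> N"
  and proj_orthogonal: "A \<in> N \<Longrightarrow> gns_inner \<rho> A (X - P X) = 0"
proof -
  obtain Y where Y: "Y \<in> N" "\<And>A. A \<in> N \<Longrightarrow> gns_inner \<rho> A (X - Y) = 0"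
    using gns_decomposition by blast
  hence "P X = Y" by (rule proj_eqI)
  thus "P X \<in> N" "A \<in> N \<Longrightarrow> gns_inner \<rho> A (X - P X) = 0"
    using Y by auto
qed

lemma gns_inner_proj: "A \<in> N \<Longrightarrow> gns_inner \<rho> A (P X) = gns_inner \<rho> A X"
  using proj_orthogonal[of A X] by (simp add: gns_inner_diff_right)

lemma proj_id: "X \<in> N \<Longrightarrow> P X = X"
  by (rule proj_eqI) (auto simp: gns_inner_zero_right)

lemma proj_add: "P (X + Y) = P X + P Y"
  by (rule proj_eqI)
     (auto simp: gns_inner_diff_right gns_inner_add_right gns_inner_proj proj_mem add_mem)

lemma proj_mscale: "P (mscale c X) = mscale c (P X)"
  by (rule proj_eqI)
     (auto simp: gns_inner_diff_right gns_inner_mscale_right gns_inner_proj proj_mem mscale_mem)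

lemma proj_diff: "P (X - Y) = P X - P Y"
  using proj_add[of X "mscale (-1) Y"] proj_mscale[of "-1" Y] by (simp add: mscale_uminus_1)

text \<open>The GNS adjoint of left multiplication by \<open>A\<close> is left multiplication by
  \<open>madj A\<close>, which preserves \<open>N\<close>.\<close>

lemma proj_mult_left: "A \<in> N \<Longrightarrow> P (A ** X) = A ** P X"
  by (rule proj_eqI)
     (auto simp: gns_inner_diff_right gns_inner_mult_left gns_inner_proj proj_mem mult_mem madj_mem)

text \<open>If \<open>Y\<close> had a least eigenvalue \<open>l < 0\<close>, then \<open>Y - l\<close> would be a singular element of \<open>N\<close>,
  hence annihilate some nonzero \<open>A\<close> in \<open>N\<close>.\<close>

lemma positive_semidef_if_gns_positive:
  assumes Y: "Y \<in> N" "madj Y = Y"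
    and pos: "\<And>A. A \<in> N \<Longrightarrow> 0 \<le> Re (gns_inner \<rho> A (Y ** A))"
  shows "positive_semidef Y"
proof -
  obtain l v where v: "v \<noteq> 0" and psd: "positive_semidef (Y - mscale (of_real l) (mat 1))"
    and null: "(Y - mscale (of_real l) (mat 1)) *v v = 0"
    using exists_least_eigenvalue[OF Y(2)] by blast
  define T where "T = Y - mscale (of_real l) (mat 1)"
  have T: "T \<in> N" unfolding T_def by (intro diff_mem Y mscale_mem one_mem)
  \<comment> \<open>Otherwise \<open>T\<close> would have a right inverse; for square matrices this
    is also a left inverse, contradicting \<open>T *v v = 0\<close>.\<close>
  have "\<exists>A\<in>N. T ** A = 0 \<and> A \<noteq> 0"
  proof (rule ccontr)
    assume "\<not> ?thesis"
    then obtain B where "T ** B = mat 1" using right_inverse_mem[OF T] by metis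
    hence "B ** T = mat 1" by (rule matrix_left_right_inverse1)
    moreover have "B *v (T *v v) = 0" using null by (simp add: T_def)
    ultimately show False using v by (simp add: matrix_vector_mul_assoc)
  qed
  then obtain A where A: "A \<in> N" "T ** A = 0" "A \<noteq> 0" by blast
  have "Y ** A = mscale (of_real l) A"
    using A(2) by (simp add: T_def matrix_diff_rdistrib mscale_mult_left)
  hence "0 \<le> l * Re (gns_inner \<rho> A A)"
    using pos[OF A(1)] by (simp add: gns_inner_mscale_right)
  moreover have "0 < Re (gns_inner \<rho> A A)"
    using gns_inner_self[of A] gns_inner_self_eq_0[of A] A(3) by (auto simp: complex_eq_iff less_le)
  ultimately have l: "0 \<le> l" by (simp add: zero_le_mult_iff)
  have "hform Y w w = hform T w w + of_real (l * (norm w)\<^sup>2)" for w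
    by (simp add: T_def hform_diff_matrix hform_mscale hform_mat_1_self)
  thus ?thesis using psd l
    by (simp add: positive_semidef_iff_hform T_def[symmetric] del: of_real_mult of_real_power)
qed

section \<open>From reality to modular invariance\<close>

lemma real_imp_invariant:
  assumes M: "unital_star_subalgebra M" "N \<subseteq> M" and "\<rho> \<in> M" and real: "real_map_on M P"
  shows "invariant_under N (modular_op \<rho>)"
  unfolding invariant_under_def
proof
  interpret M: star_subalgebra M by unfold_locales (rule M)
  have P_madj: "P (madj X) = madj (P X)" if X: "X \<in> M" for X
  proof -
    have sa: "madj (P Z) = P Z" if "Z \<in> M" "madj Z = Z" for Z
      using real that by (simp add: real_map_on_def)
    \<comment> \<open>Two self-adjoint combinations of \<open>X\<close> and \<open>madj X\<close>;
      reality of \<open>P\<close> on both determines how \<open>P\<close> acts on the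
      adjoint.\<close>
    define Z1 where "Z1 = X + madj X"
    define Z2 where "Z2 = mscale \<i> (X - madj X)"
    have Z: "madj (P Z1) = P Z1" "madj (P Z2) = P Z2"
      unfolding Z1_def Z2_def
      by (auto intro!: sa M.add_mem M.diff_mem M.mscale_mem M.madj_mem X
          simp: madj_add madj_mscale madj_diff)
         (auto simp: vec_eq_iff mscale_nth algebra_simps)
    have "madj (P X) $ i $ j = P (madj X) $ i $ j" for i j
      using arg_cong[OF Z(1), of "\<lambda>A. A $ i $ j"] arg_cong[OF Z(2), of "\<lambda>A. A $ i $ j"]
      by (simp add: Z1_def Z2_def proj_add proj_diff proj_mscale madj_nth mscale_nth complex_eq_iff)
    thus ?thesis by (simp add: vec_eq_iff)
  qed
  fix A assume A: "A \<in> N"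
  define B where "B = modular_op \<rho> A"
  have B: "B \<in> M"
    unfolding B_def modular_op_def
    using A M(2) \<open>\<rho> \<in> M\<close> rho_inv by (auto intro: M.mult_mem M.matrix_inv_mem)
  have rho: "\<rho> ** A = B ** \<rho>"
    by (simp add: B_def modular_op_def invertible_matrix_inv[OF rho_inv] flip: matrix_mul_assoc)
  define K where "K = B - P B"
  have K: "K \<in> M" unfolding K_def using B proj_mem M(2) by (auto intro: M.diff_mem)
  have "P K = 0" by (simp add: K_def proj_diff proj_id proj_mem)
  hence "P (madj K) = 0" using P_madj[OF K] by (simp add: vec_eq_iff madj_nth)
  hence "gns_inner \<rho> (madj A) (madj K) = 0"
    using proj_orthogonal[OF madj_mem[OF A], of "madj K"] by simp
  \<comment> \<open>Since \<open>\<rho> ** A = B ** \<rho>\<close>, cyclicity of the trace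
    identifies this number with the preceding one.\<close>
  hence "gns_inner \<rho> K B = 0"
    using gns_inner_mult_right[OF rho, of K "mat 1"]
    by (simp add: gns_inner_def madj_mult matrix_mul_assoc)
  moreover have "gns_inner \<rho> K (P B) = 0"
    using proj_orthogonal[OF proj_mem, of B B] gns_inner_cnj[of "P B" K] by (simp add: K_def)
  ultimately have "gns_inner \<rho> K (B - P B) = 0"
    by (simp add: gns_inner_diff_right)
  hence "gns_inner \<rho> K K = 0" by (simp only: K_def)
  hence "B = P B" using gns_inner_self_eq_0 by (fastforce simp: K_def)
  thus "modular_op \<rho> A \<in> N" using proj_mem by (metis B_def)
qed

section \<open>Consequences of modular invariance\<close>

context
  assumes invariant: "invariant_under N (modular_op \<rho>)"
begin

text \<open>Invariance under the inverse modular operator is what is needed. It follows by taking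
  adjoints: since \<open>\<rho>\<close> is self-adjoint, the adjoint of
  \<open>modular_op \<rho> (madj B)\<close> is
  \<open>matrix_inv \<rho> ** B ** \<rho>\<close>.\<close>

lemma invariant_commute:
  assumes "B \<in> N"
  obtains D where "D \<in> N" "\<rho> ** D = B ** \<rho>"
proof
  let ?D = "madj (modular_op \<rho> (madj B))"
  show "?D \<in> N"
    using assms invariant by (simp add: invariant_under_def madj_mem)
  have "modular_op \<rho> (madj B) ** \<rho> = \<rho> ** madj B"
    by (simp add: modular_op_def invertible_matrix_inv[OF rho_inv] flip: matrix_mul_assoc)
  from arg_cong[OF this, of madj] show "\<rho> ** ?D = B ** \<rho>"
    by (simp add: madj_mult madj_rho)
qed

lemma proj_mult_right:
  assumes B: "B \<in> N"
  shows "P (X ** B) = P X ** B"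
proof (rule proj_eqI)
  show "P X ** B \<in> N" by (intro mult_mem proj_mem B)
  obtain D where D: "D \<in> N" "\<rho> ** D = B ** \<rho>"
    using invariant_commute[OF B] by blast
  fix A assume "A \<in> N"
  thus "gns_inner \<rho> A (X ** B - P X ** B) = 0"
    by (simp add: gns_inner_mult_right[OF D(2)] gns_inner_proj mult_mem madj_mem D(1)
        flip: matrix_diff_rdistrib)
       (simp add: gns_inner_proj mult_mem madj_mem D(1) gns_inner_diff_right)
qed

lemma proj_madj: "P (madj X) = madj (P X)"
proof (rule proj_eqI)
  show "madj (P X) \<in> N" by (intro madj_mem proj_mem)
  fix A assume "A \<in> N"
  then obtain D where D: "D \<in> N" "\<rho> ** D = A ** \<rho>"
    using invariant_commute by blast
  show "gns_inner \<rho> A (madj X - madj (P X)) = 0"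
    using gns_inner_madj_right[OF D(2), of "X - P X"] proj_orthogonal[OF madj_mem[OF D(1)]]
    by (simp add: madj_diff)
qed

lemma proj_positive_semidef:
  assumes Z: "positive_semidef Z"
  shows "positive_semidef (P Z)"
proof (rule positive_semidef_if_gns_positive[OF proj_mem])
  show "madj (P Z) = P Z"
    using proj_madj[of Z] positive_semidef_madj[OF Z] by simp
  fix A assume A: "A \<in> N"
  have "gns_inner \<rho> A (P Z ** A) = gns_inner \<rho> A (Z ** A)"
    using gns_inner_proj[OF A, of "Z ** A"] by (simp add: proj_mult_right[OF A])
  thus "0 \<le> Re (gns_inner \<rho> A (P Z ** A))"
    using gns_inner_positive_semidef[OF Z, of A] by (simp add: complex_nonneg_Reals_iff)
qed

text \<open>The Schwarz inequality is positivity of the projection applied to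
  \<open>(X - P X)\<^sup>* (X - P X)\<close>.\<close>

lemma invariant_imp_conditional_expectation:
  assumes M: "N \<subseteq> M"
  shows "conditional_expectation M N P"
  unfolding conditional_expectation_def linear_map_on_def loewner_le_def
proof (intro conjI ballI allI impI)
  show "P ` M = N"
    using M proj_mem proj_id by (auto intro: rev_image_eqI)
  show "P (P X) = P X" for X by (simp add: proj_id proj_mem)
  show "P (mat 1) = mat 1" by (simp add: proj_id one_mem)
  show "positive_semidef (P Y - P X)" if "positive_semidef (Y - X)" for X Y
    using proj_positive_semidef[OF that] by (simp add: proj_diff)
  show "P (A ** X ** B) = A ** P X ** B" if "A \<in> N" "B \<in> N" for A B X
    using that by (simp add: proj_mult_left proj_mult_right)
  show "positive_semidef (P (madj X ** X) - madj (P X) ** P X)" for X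
  proof -
    let ?Y = "P X"
    \<comment> \<open>By bimodularity and compatibility with adjoints, \<open>P\<close> sends both
      cross terms and the last term to \<open>madj ?Y ** ?Y\<close>, so one copy survives with a
      minus sign.\<close>
    have "P (madj (X - ?Y) ** (X - ?Y)) = P (madj X ** X) - madj ?Y ** ?Y"
      by (simp add: madj_diff matrix_diff_ldistrib matrix_diff_rdistrib proj_diff proj_madj
          proj_mult_left proj_mult_right proj_mem madj_mem mult_mem proj_id)
    thus ?thesis
      using proj_positive_semidef[OF positive_semidef_square, of "X - ?Y"] by simp
  qed
qed (simp_all add: proj_add proj_mscale)

end

end

theorem theorem4p3:
  fixes M N :: "(complex^'n^'n) set" and \<rho> :: "complex^'n^'n"
  assumes "unital_star_subalgebra M"
    and "von_neumann_subalgebra N M"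
    and "faithful_state_on M \<rho>"
  shows "(conditional_expectation M N (gns_proj \<rho> N) \<longleftrightarrow> invariant_under N (modular_op \<rho>)) \<and>
         (conditional_expectation M N (gns_proj \<rho> N) \<longleftrightarrow> real_map_on M (gns_proj \<rho> N))"
proof -
  have sub: "N \<subseteq> M" and rho: "\<rho> \<in> M"
    using assms by (auto simp: von_neumann_subalgebra_def faithful_state_on_def state_on_def)
  interpret gns_subalgebra N \<rho>
    using assms by unfold_locales
      (auto simp: von_neumann_subalgebra_def faithful_state_on_def state_on_def)
  \<comment> \<open>The three implications form a cycle: conditional expectation, real, invariant,
    conditional expectation.\<close>
  show ?thesis
    using conditional_expectation_imp_real[OF assms(1)] real_imp_invariant[OF assms(1) sub rho]
      invariant_imp_conditional_expectation[OF _ sub] by blast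
qed

end
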